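(* Let $d\ge 2$ be even, let $p, K$ be any two positive integers, and let $L, D > 0$. Then, for any consistent $1$-SCLI algorithm $\mathcal{A}$ over $\mathbb{R}^d$ (with mappings $C_0, N$) acting on instances from $\mathcal{F}_{L,D}$, initialized at $\boldsymbol{u}_0 = \mathbf{0}$, and for which $N(\boldsymbol{A})$ is a matrix polynomial in $\boldsymbol{A}$ (with real coefficients not depending on $\boldsymbol{A}$ or $\boldsymbol{b}$) of degree at most $p-1$, $$\sup_{F \in \mathcal{F}_{L, D}} \|F(\boldsymbol{u}_K)\| \geq \frac{LD}{4p\sqrt{5K}},$$ where, for each $F\in\mathcal{F}_{L,D}$, $\boldsymbol{u}_K$ denotes the $K$-th iterate produced by $\mathcal{A}$ on the instance $F$ started at $\boldsymbol{u}_0=\mathbf{0}$.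
   Context: $\|\cdot\| = \sqrt{\langle\cdot,\cdot\rangle}$ is the Euclidean norm on $\mathbb{R}^d$. An operator $F:\mathbb{R}^d\to\mathbb{R}^d$ is $\frac1L$-cocoercive if $\langle F(\boldsymbol{u})-F(\boldsymbol{v}),\boldsymbol{u}-\boldsymbol{v}\rangle\ge \frac1L\|F(\boldsymbol{u})-F(\boldsymbol{v})\|^2$ for all $\boldsymbol{u},\boldsymbol{v}\in\mathbb{R}^d$. $\mathcal{F}_{L,D}$ is the class of problems with $\frac1L$-cocoercive operators $F$ that satisfy $\|\boldsymbol{u}^*-\boldsymbol{u}_0\|\le D$, where $\boldsymbol{u}_0$ is the initial point and $\boldsymbol{u}^*$ is such that $F(\boldsymbol{u}^* )=\mathbf{0}$. Since $1$-SCLI algorithms act on operators of the form $F(\boldsymbol{u})=\boldsymbol{A}\boldsymbol{u}+\boldsymbol{b}$ with $\boldsymbol{A}\in\mathbb{R}^{d\times d}$, $\boldsymbol{b}\in\mathbb{R}^d$, the instances considered are those of this form. An algorithm acting on the class of operators $F(\boldsymbol{u})=\boldsymbol{A}\boldsymbol{u}+\boldsymbol{b}$ is $1$-SCLI ($1$-stationary canonical linear iterative) over $\mathbb{R}^d$ if, given an initial point $\boldsymbol{u}_0\in\mathbb{R}^d$, there exist mappings $C_0, N:\mathbb{R}^{d\times d}\to\mathbb{R}^{d\times d}$ such that for all $k\ge1$ its iterates can be expressed as $$\boldsymbol{u}_k = C_0(\boldsymbol{A})\boldsymbol{u}_{k-1}+N(\boldsymbol{A})\boldsymbol{b}.$$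 A $1$-SCLI algorithm is consistent with respect to a full-rank matrix $\boldsymbol{A}$ if for any $\boldsymbol{b}\in\mathbb{R}^d$ the iterates $\boldsymbol{u}_k$ converge to $\boldsymbol{u}^*=-\boldsymbol{A}^{-1}\boldsymbol{b}$. It is consistent if it is consistent with respect to any full-rank matrix $\boldsymbol{A}$. *)

theory Defs
  imports "HOL-Analysis.Analysis" "HOL-Computational_Algebra.Polynomial"
begin

definition cocoercive :: "real \<Rightarrow> ('a::real_inner \<Rightarrow> 'a) \<Rightarrow> bool" where
  "cocoercive c F \<longleftrightarrow> (\<forall>u v. inner (F u - F v) (u - v) \<ge> c * (norm (F u - F v))\<^sup>2)"

definition affine_op :: "real^'n^'n \<Rightarrow> real^'n \<Rightarrow> real^'n \<Rightarrow> real^'n" where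
  "affine_op A b v = A *v v + b"

text \<open>The affine instances of the problem class with initial point \<open>u\<^sub>0\<close>. The operator
  \<open>v \<mapsto> A v + b\<close> is represented by the pair \<open>(A, b)\<close>, which it determines uniquely.\<close>

definition problem_class :: "real \<Rightarrow> real \<Rightarrow> real^'n \<Rightarrow> ((real^'n^'n) \<times> (real^'n)) set" where
  "problem_class L D u\<^sub>0 = {(A, b). cocoercive (1 / L) (affine_op A b) \<and>
     (\<exists>u. affine_op A b u = 0 \<and> norm (u - u\<^sub>0) \<le> D)}"

text \<open>An algorithm with its initial point fixed is the map \<open>U\<close> that sends an instance
  \<open>(A, b)\<close> to the sequence of iterates \<open>U A b 0, U A b 1, \<dots>\<close>.\<close>

type_synonym 'n algorithm = "real^'n^'n \<Rightarrow> real^'n \<Rightarrow> nat \<Rightarrow> real^'n"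

definition is_1_SCLI ::
  "real^'n \<Rightarrow> (real^'n^'n \<Rightarrow> real^'n^'n) \<Rightarrow> (real^'n^'n \<Rightarrow> real^'n^'n) \<Rightarrow> 'n::finite algorithm \<Rightarrow> bool"
  where
  "is_1_SCLI u\<^sub>0 C\<^sub>0 N U \<longleftrightarrow> (\<forall>A b. U A b 0 = u\<^sub>0 \<and>
     (\<forall>k\<ge>1. U A b k = C\<^sub>0 A *v U A b (k - 1) + N A *v b))"

definition consistent_wrt :: "'n::finite algorithm \<Rightarrow> real^'n^'n \<Rightarrow> bool" where
  "consistent_wrt U A \<longleftrightarrow> (\<forall>b. U A b \<longlonglongrightarrow> - (matrix_inv A *v b))"

text \<open>Consistency of an algorithm that acts on operators with matrices in \<open>S\<close>. The set \<open>S\<close> matters: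
  with \<open>S = UNIV\<close> no 1-SCLI algorithm whose \<open>N\<close> is a matrix polynomial \<open>q\<close> is consistent,
  since consistency with respect to \<open>t I\<close> requires \<open>\<bar>1 + t q(t)\<bar> < 1\<close>, which
  no real polynomial satisfies for all real \<open>t \<noteq> 0\<close>.\<close>

definition consistent_on :: "(real^'n^'n) set \<Rightarrow> 'n::finite algorithm \<Rightarrow> bool" where
  "consistent_on S U \<longleftrightarrow> (\<forall>A\<in>S. rank A = CARD('n) \<longrightarrow> consistent_wrt U A)"

lemma consistent_on_mono: "consistent_on T U \<Longrightarrow> S \<subseteq> T \<Longrightarrow> consistent_on S U"
  unfolding consistent_on_def by blast

text \<open>The type class power on \<open>real^'n^'n\<close> is componentwise, so matrix powers are iterated
  \<open>(**)\<close> here.\<close>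

definition matrix_poly :: "real poly \<Rightarrow> real^'n^'n \<Rightarrow> real^'n^'n" where
  "matrix_poly q A = (\<Sum>i\<le>degree q. coeff q i *\<^sub>R (((**) A ^^ i) (mat 1)))"

end

theory Submission
  imports Defs
begin

text \<open>The idea is to run the algorithm on matrices that act as multiplication by a complex number,
  and to read off the rate from a single real polynomial on \<open>[0, 1]\<close>.

  Since the dimension is even, \<open>\<real>\<^sup>d\<close> carries an orthogonal \<open>J\<close> with \<open>J\<^sup>2 = -I\<close>, and
  \<open>z \<mapsto> Re z I + Im z J\<close> embeds the complex numbers in the matrices. The image of \<open>z\<close>
  scales norms by \<open>|z|\<close> and is \<open>1/L\<close>-cocoercive when \<open>|z|\<^sup>2 \<le> L Re z\<close>, that is, on the
  disc with diameter \<open>[0, L]\<close>. Only its boundary circle \<open>|z|\<^sup>2 = L Re z\<close> is used.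

  Consistency makes every solution a fixed point of the iteration, which forces
  \<open>C\<^sub>0(A) = I + N(A) A\<close> for the nonsingular \<open>A\<close> of the class. So for \<open>A\<close> given by \<open>z\<close>
  the residual after \<open>K\<close> steps has norm \<open>|z| |P(z)|\<^sup>K |u*|\<close>, where \<open>P(x) = 1 + x q(x)\<close> has
  real coefficients, degree at most \<open>p\<close> and \<open>P(0) = 1\<close> (\<open>SCLI_residual_cmatrix\<close>). Convergence
  gives \<open>|P(z)| \<le> 1\<close>.

  On the circle, \<open>|P(z)|\<^sup>2\<close> is a real polynomial of degree at most \<open>p\<close> in \<open>y = |z|\<^sup>2\<close>
  (\<open>circle_norm_squared_eq_poly\<close>). After scaling, this is a polynomial \<open>r\<close> with values in \<open>[0, 1]\<close>
  on \<open>[0, 1]\<close> and \<open>r(0) = 1\<close>. Such an \<open>r\<close> cannot leave the value 1 faster than the shifted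
  Chebyshev polynomial: \<open>r(sin\<^sup>2 t) \<ge> cos\<^sup>2(p t)\<close> for small \<open>t\<close>
  (\<open>unit_interval_poly_ge_cos_squared\<close>). With \<open>p t\<close> of size \<open>1 / sqrt K\<close> the power \<open>r\<^sup>K\<close> is still
  at least 1/2, while \<open>y = sin\<^sup>2 t\<close> is of size \<open>1 / (K p\<^sup>2)\<close>; taking the square root of
  \<open>y r(y)\<^sup>K\<close> gives the bound.\<close>

section \<open>Polynomials bounded on the unit interval\<close>

lemma lagrange_interpolation:
  fixes q :: "'a::field poly"
  assumes "finite X" and "degree q < card X"
  shows "poly q a = (\<Sum>x\<in>X. poly q x * (\<Prod>y\<in>X - {x}. (a - y) / (x - y)))"
proof -
  define l where "l = (\<Sum>x\<in>X. smult (poly q x) (\<Prod>y\<in>X - {x}. smult (1 / (x - y)) [:- y, 1:]))"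
  have poly_l: "poly l z = (\<Sum>x\<in>X. poly q x * (\<Prod>y\<in>X - {x}. (z - y) / (x - y)))" for z
    by (simp add: l_def poly_sum poly_prod divide_inverse algebra_simps)
  have "degree (\<Prod>y\<in>X - {x}. smult (1 / (x - y)) [:- y, 1:]) \<le> card X - 1" if "x \<in> X" for x
  proof -
    have "degree (\<Prod>y\<in>X - {x}. smult (1 / (x - y)) [:- y, 1:])
        \<le> (\<Sum>y\<in>X - {x}. degree (smult (1 / (x - y)) [:- y, 1:]))"
      using degree_prod_sum_le[of "X - {x}" "\<lambda>y. smult (1 / (x - y)) [:- y, 1:]"] assms(1)
      by (simp add: o_def)
    also have "\<dots> \<le> (\<Sum>y\<in>X - {x}. 1)"
      by (intro sum_mono) (simp add: degree_smult_le)
    also have "\<dots> = card X - 1"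
      using that assms(1) by simp
    finally show ?thesis .
  qed
  hence "degree l \<le> card X - 1"
    unfolding l_def using assms(1) by (intro degree_sum_le) (auto intro: order.trans[OF degree_smult_le])
  moreover have "poly q z = poly l z" if "z \<in> X" for z
  proof -
    have "(\<Prod>y\<in>X - {x}. (z - y) / (x - y)) = (if x = z then 1 else 0)" if "x \<in> X" for x
      using \<open>z \<in> X\<close> assms(1) by (auto intro!: prod.neutral)
    hence "poly l z = (\<Sum>x\<in>X. if x = z then poly q x else 0)"
      unfolding poly_l by (intro sum.cong) simp_all
    thus ?thesis
      using that assms(1) by simp
  qed
  ultimately have "q = l"
    using assms(2) by (intro poly_eqI_degree[of X]) auto
  thus ?thesis using poly_l by metis
qed

text \<open>In Lagrange's formula at \<open>a\<close>, which lies between the first two nodes, the basis polynomial of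
  the node \<open>y j\<close> has sign \<open>(-1)\<^sup>j\<^sup>-\<^sup>1\<close>. So all summands are nonnegative when the values of
  \<open>q\<close> alternate in sign and the value at \<open>y 0\<close> vanishes.\<close>
lemma alternating_signs_imp_nonneg:
  fixes q :: "real poly" and y :: "nat \<Rightarrow> real"
  assumes "degree q \<le> p"
    and mono: "\<And>i j. i < j \<Longrightarrow> j \<le> p \<Longrightarrow> y i < y j"
    and "poly q (y 0) = 0"
    and sign: "\<And>j. 1 \<le> j \<Longrightarrow> j \<le> p \<Longrightarrow> (- 1) ^ j * poly q (y j) \<le> 0"
    and "y 0 < a" and a_le: "1 \<le> p \<Longrightarrow> a \<le> y 1"
  shows "0 \<le> poly q a"
proof -
  have inj: "inj_on y {..p}"
    using mono by (intro inj_onI) (metis atMost_iff less_irrefl linorder_neqE_nat)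
  have image_diff: "y ` {..p} - {y j} = y ` ({..p} - {j})" if "j \<le> p" for j
    using inj that by (simp add: inj_on_image_set_diff[of y "{..p}"])
  have "poly q a = (\<Sum>x\<in>y ` {..p}. poly q x * (\<Prod>z\<in>y ` {..p} - {x}. (a - z) / (x - z)))"
    using assms(1) inj by (intro lagrange_interpolation) (auto simp: card_image)
  also have "\<dots> = (\<Sum>j\<le>p. poly q (y j) * (\<Prod>z\<in>y ` {..p} - {y j}. (a - z) / (y j - z)))"
    using inj by (simp add: sum.reindex)
  also have "\<dots> = (\<Sum>j\<le>p. poly q (y j) * (\<Prod>i\<in>{..p} - {j}. (a - y i) / (y j - y i)))"
    using inj_on_subset[OF inj] by (intro sum.cong) (auto simp: image_diff prod.reindex)
  also have "\<dots> \<ge> 0"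
  proof (intro sum_nonneg)
    fix j assume "j \<in> {..p}"
    hence "j \<le> p" by simp
    show "0 \<le> poly q (y j) * (\<Prod>i\<in>{..p} - {j}. (a - y i) / (y j - y i))"
    proof (cases "j = 0")
      case True
      thus ?thesis using assms(3) by simp
    next
      case False
      have a_le_y: "a \<le> y i" if "1 \<le> i" "i \<le> p" for i
        using that a_le mono[of 1 i] by (cases "i = 1") auto
      have split: "{..p} - {j} = insert 0 {1..<j} \<union> {j<..p}"
        using False \<open>j \<le> p\<close> by auto
      have "(\<Prod>i\<in>{..p} - {j}. (a - y i) / (y j - y i))
          = (\<Prod>i\<in>insert 0 {1..<j}. (a - y i) / (y j - y i)) * (\<Prod>i\<in>{j<..p}. (a - y i) / (y j - y i))"
        unfolding split using False by (intro prod.union_disjoint) auto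
      also have "\<dots> = (a - y 0) / (y j - y 0) * (\<Prod>i\<in>{1..<j}. (a - y i) / (y j - y i))
          * (\<Prod>i\<in>{j<..p}. (a - y i) / (y j - y i))"
        by simp
      also have "(\<Prod>i\<in>{1..<j}. (a - y i) / (y j - y i))
          = (\<Prod>i\<in>{1..<j}. - ((y i - a) / (y j - y i)))"
        by (intro prod.cong refl) (metis minus_diff_eq minus_divide_left)
      also have "\<dots> = (- 1) ^ (j - 1) * (\<Prod>i\<in>{1..<j}. (y i - a) / (y j - y i))"
        by (subst prod_uminus) simp
      finally have *: "poly q (y j) * (\<Prod>i\<in>{..p} - {j}. (a - y i) / (y j - y i))
          = (((- 1) ^ (j - 1) * poly q (y j)) * ((a - y 0) / (y j - y 0)))
            * (\<Prod>i\<in>{1..<j}. (y i - a) / (y j - y i)) * (\<Prod>i\<in>{j<..p}. (a - y i) / (y j - y i))"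
        by (simp only: mult_ac)
      have "0 \<le> (- 1) ^ (j - 1) * poly q (y j)"
        using sign[of j] False \<open>j \<le> p\<close> by (cases j) auto
      moreover have "0 \<le> (a - y 0) / (y j - y 0)"
        using mono[of 0 j] False \<open>j \<le> p\<close> \<open>y 0 < a\<close> by simp
      moreover have "0 \<le> (\<Prod>i\<in>{1..<j}. (y i - a) / (y j - y i))"
        using a_le_y less_imp_le[OF mono] \<open>j \<le> p\<close> by (intro prod_nonneg divide_nonneg_nonneg) auto
      moreover have "0 \<le> (\<Prod>i\<in>{j<..p}. (a - y i) / (y j - y i))"
        using a_le_y mono False by (intro prod_nonneg divide_nonpos_neg) auto
      ultimately show ?thesis
        unfolding * by (rule mult_nonneg_nonneg[OF mult_nonneg_nonneg[OF mult_nonneg_nonneg]])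
    qed
  qed
  finally show ?thesis .
qed

text \<open>This is the Chebyshev polynomial \<open>T\<^sub>n(1 - 2 y)\<close>, from its three-term recurrence.\<close>
lemma cos_multiple_eq_poly_sin_squared:
  "\<exists>c :: real poly. degree c \<le> n \<and> (\<forall>t. poly c ((sin t)\<^sup>2) = cos (2 * real n * t))"
proof (induction n rule: induct_nat_012)
  case 0
  show ?case by (intro exI[of _ 1]) auto
next
  case 1
  show ?case by (intro exI[of _ "[:1, - 2:]"]) (auto simp: cos_double_sin)
next
  case (ge2 n)
  then obtain b c :: "real poly" where
    b: "degree b \<le> n" "\<And>t. poly b ((sin t)\<^sup>2) = cos (2 * real n * t)" and
    c: "degree c \<le> Suc n" "\<And>t. poly c ((sin t)\<^sup>2) = cos (2 * real (Suc n) * t)"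
    by blast
  have "cos (2 * real (Suc (Suc n)) * t) = 2 * (1 - 2 * (sin t)\<^sup>2) * cos (2 * real (Suc n) * t) - cos (2 * real n * t)"
    for t
  proof -
    have "cos (2 * real (Suc (Suc n)) * t) = cos (2 * real (Suc n) * t + 2 * t)"
      "cos (2 * real n * t) = cos (2 * real (Suc n) * t - 2 * t)"
      by (auto intro!: arg_cong[of _ _ cos] simp: algebra_simps)
    thus ?thesis by (simp add: cos_add cos_diff cos_double_sin[of t])
  qed
  moreover have "degree ([:2, - 4:] * c - b) \<le> Suc (Suc n)"
  proof -
    have "degree ([:2, - 4:] * c) \<le> Suc (Suc n)"
      using degree_mult_le[of "[:2, - 4:]" c] c(1) by simp
    thus ?thesis using b(1) by (intro degree_diff_le) auto
  qed
  ultimately show ?case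
    using b(2) c(2) by (intro exI[of _ "[:2, - 4:] * c - b"]) (simp add: algebra_simps)
qed

lemma cos_sq_multiple_half_pi:
  "even j \<Longrightarrow> (cos (real j * pi / 2))\<^sup>2 = 1" "odd j \<Longrightarrow> (cos (real j * pi / 2))\<^sup>2 = 0"
  by (auto elim!: evenE oddE simp: cos_add add_divide_distrib distrib_right mult.commute[of _ 2]
      simp flip: power_mult)

text \<open>The polynomial \<open>\<tau>\<close> with \<open>\<tau>(sin\<^sup>2 t) = cos\<^sup>2(p t)\<close> takes the values 1 and 0 alternately at the
  \<open>p + 1\<close> nodes \<open>sin\<^sup>2(j \<pi> / (2 p))\<close>. Since \<open>r\<close> stays between 0 and 1 and equals
  \<open>\<tau>\<close> at 0, the difference \<open>r - \<tau>\<close> has alternating signs at these nodes. It is therefore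
  nonnegative up to the first node after 0, which is \<open>sin\<^sup>2 t\<close> for \<open>p t = \<pi>/2\<close>.\<close>
lemma unit_interval_poly_ge_cos_squared:
  fixes r :: "real poly"
  assumes "degree r \<le> p" "1 \<le> p" "poly r 0 = 1"
    and bounds: "\<And>y. 0 < y \<Longrightarrow> y \<le> 1 \<Longrightarrow> 0 \<le> poly r y \<and> poly r y \<le> 1"
    and t: "0 < t" "real p * t \<le> pi / 2"
  shows "(cos (real p * t))\<^sup>2 \<le> poly r ((sin t)\<^sup>2)"
proof -
  obtain c :: "real poly" where c: "degree c \<le> p" "\<And>t. poly c ((sin t)\<^sup>2) = cos (2 * real p * t)"
    using cos_multiple_eq_poly_sin_squared by blast
  define \<tau> where "\<tau> = smult (1 / 2) (c + 1)"
  have \<tau>: "poly \<tau> ((sin t)\<^sup>2) = (cos (real p * t))\<^sup>2" for t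
    using cos_double_cos[of "real p * t"] by (simp add: \<tau>_def c mult.assoc)
  have "degree \<tau> \<le> p"
    unfolding \<tau>_def using c(1) by (intro order.trans[OF degree_smult_le] degree_add_le) auto
  define y where "y j = (sin (real j * (pi / (2 * real p))))\<^sup>2" for j :: nat
  have sin_mono: "(sin a)\<^sup>2 < (sin b)\<^sup>2" if "0 \<le> a" "a < b" "b \<le> pi / 2" for a b
    using that by (intro power_strict_mono sin_monotone_2pi sin_ge_zero) auto
  have angle: "real p * (real j * (pi / (2 * real p))) = real j * pi / 2" for j
    using assms(2) by (simp add: field_simps)
  have angle_le: "real j * (pi / (2 * real p)) \<le> pi / 2" if "j \<le> p" for j
    using assms(2) that by (simp add: field_simps)
  have y_mono: "y i < y j" if "i < j" "j \<le> p" for i j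
    unfolding y_def using that angle_le assms(2) by (intro sin_mono) (auto simp: field_simps)
  have y_le: "y j \<le> 1" for j
    by (simp add: y_def abs_square_le_1)
  have y_0: "y 0 = 0" by (simp add: y_def)
  have \<tau>_y: "poly \<tau> (y j) = (if even j then 1 else 0)" for j
    unfolding y_def \<tau> angle using cos_sq_multiple_half_pi by simp
  have "0 \<le> poly (r - \<tau>) ((sin t)\<^sup>2)"
  proof (rule alternating_signs_imp_nonneg[where p = p and y = y])
    show "degree (r - \<tau>) \<le> p"
      using assms(1) \<open>degree \<tau> \<le> p\<close> by (rule degree_diff_le)
    show "poly (r - \<tau>) (y 0) = 0"
      using \<tau>_y[of 0] assms(3) by (simp add: y_0)
    show "(- 1) ^ j * poly (r - \<tau>) (y j) \<le> 0" if "1 \<le> j" "j \<le> p" for j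
      using bounds[of "y j"] y_mono[of 0 j] that y_le[of j] by (simp add: \<tau>_y y_0)
    have t_le: "t \<le> pi / (2 * real p)"
      using t assms(2) by (simp add: field_simps)
    have first_le: "pi / (2 * real p) \<le> pi / 2"
      using angle_le[of 1] assms(2) by simp
    show "(sin t)\<^sup>2 \<le> y 1"
      using sin_mono[of t "pi / (2 * real p)"] t(1) t_le first_le by (cases "t = pi / (2 * real p)") (auto simp: y_def)
    show "y 0 < (sin t)\<^sup>2"
      unfolding y_0 using sin_mono[of 0 t] t(1) t_le first_le by simp
  qed (use y_mono in auto)
  thus ?thesis using \<tau> by simp
qed

lemma half_le_sin:
  fixes t :: real assumes "0 \<le> t" "t \<le> 1" shows "t / 2 \<le> sin t"
proof -
  have "\<bar>sin t - t\<bar> \<le> t ^ 3 / 6"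
    using Maclaurin_sin_bound[of t 3] assms by (simp add: numeral_3_eq_3 sin_coeff_def fact_numeral)
  moreover have "t ^ 3 \<le> t" using assms power_decreasing[of 1 3 t] by simp
  ultimately show ?thesis using assms by linarith
qed

text \<open>For \<open>y r(y)\<^sup>K\<close> to be large, \<open>y\<close> should be large, but \<open>r(y)\<close> must be within
  about \<open>1/K\<close> of 1 for its power to survive. The angle \<open>\<alpha> = 1 / sqrt(2 K)\<close> gives
  \<open>r(y) \<ge> cos\<^sup>2 \<alpha> \<ge> 1 - 1 / (2 K)\<close>, so Bernoulli's inequality yields \<open>r(y)\<^sup>K \<ge> 1/2\<close>.\<close>
lemma exists_large_damped_value:
  fixes r :: "real poly"
  assumes "degree r \<le> p" "1 \<le> p" "1 \<le> K" "poly r 0 = 1"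
    and bounds: "\<And>y. 0 < y \<Longrightarrow> y \<le> 1 \<Longrightarrow> 0 \<le> poly r y \<and> poly r y \<le> 1"
  shows "\<exists>y. 0 < y \<and> y \<le> 1 \<and> 1 / (16 * real K * (real p)\<^sup>2) \<le> y * poly r y ^ K"
proof -
  define \<alpha> where "\<alpha> = 1 / sqrt (2 * real K)"
  define t where "t = \<alpha> / real p"
  have \<alpha>: "0 < \<alpha>" "\<alpha>\<^sup>2 = 1 / (2 * real K)"
    using assms(3) by (auto simp: \<alpha>_def power_divide)
  have "\<alpha>\<^sup>2 \<le> 1\<^sup>2" unfolding \<alpha> using assms(3) by simp
  hence "\<alpha> \<le> 1" by (rule power2_le_imp_le) simp
  have t: "0 < t" "real p * t = \<alpha>" "t \<le> 1"
    using \<alpha>(1) \<open>\<alpha> \<le> 1\<close> assms(2) by (auto simp: t_def divide_le_eq)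
  have "t / 2 \<le> sin t" using t by (intro half_le_sin) auto
  hence "(t / 2)\<^sup>2 \<le> (sin t)\<^sup>2" using t by (intro power_mono) auto
  moreover have "(t / 2)\<^sup>2 = 1 / (8 * real K * (real p)\<^sup>2)"
    by (simp add: t_def power_divide \<alpha>(2))
  ultimately have y: "1 / (8 * real K * (real p)\<^sup>2) \<le> (sin t)\<^sup>2" by simp
  have "(sin \<alpha>)\<^sup>2 \<le> \<alpha>\<^sup>2"
    using abs_sin_x_le_abs_x[of \<alpha>] by (simp add: abs_le_square_iff)
  hence "1 - 1 / (2 * real K) \<le> (cos \<alpha>)\<^sup>2" using \<alpha>(2) by (simp add: cos_squared_eq)
  also have "\<dots> \<le> poly r ((sin t)\<^sup>2)"
    using unit_interval_poly_ge_cos_squared[OF assms(1,2,4) bounds, of t] t \<open>\<alpha> \<le> 1\<close> pi_ge_two by simp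
  finally have base: "1 + (- 1 / (2 * real K)) \<le> poly r ((sin t)\<^sup>2)" by simp
  have "1 / 2 = 1 + real K * (- 1 / (2 * real K))" using assms(3) by simp
  also have "\<dots> \<le> (1 + (- 1 / (2 * real K))) ^ K"
    using assms(3) by (intro Bernoulli_inequality) (simp add: field_simps)
  also have "\<dots> \<le> poly r ((sin t)\<^sup>2) ^ K"
    using base assms(3) by (intro power_mono) (auto simp: field_simps)
  finally have "1 / (8 * real K * (real p)\<^sup>2) * (1 / 2) \<le> (sin t)\<^sup>2 * poly r ((sin t)\<^sup>2) ^ K"
    using y by (intro mult_mono) auto
  moreover have "0 < (sin t)\<^sup>2"
    using \<open>t / 2 \<le> sin t\<close> t by auto
  ultimately show ?thesis
    by (intro exI[of _ "(sin t)\<^sup>2"]) (simp add: abs_square_le_1)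
qed

section \<open>Real polynomials on a circle through the origin\<close>

text \<open>On the circle, \<open>Re z\<close> and \<open>(Im z)\<^sup>2\<close> are polynomials in \<open>y = |z|\<^sup>2\<close>. The induction splits
  off the constant term, \<open>w = c\<^sub>0 + z v\<close>, and uses
  \<open>|w|\<^sup>2 = c\<^sub>0\<^sup>2 + 2 c\<^sub>0 Re(z v) + y |v|\<^sup>2\<close>. The term \<open>Re(z v)\<close> involves
  \<open>Im z Im v\<close>, so \<open>Re w\<close> and \<open>Im z Im w\<close> are carried along.\<close>
lemma circle_norm_squared_eq_poly:
  fixes c :: "nat \<Rightarrow> real" and L :: real
  assumes "L \<noteq> 0"
  shows "\<exists>r a b :: real poly. degree r \<le> n \<and> degree a \<le> n \<and> degree b \<le> Suc n \<and>
    (\<forall>z :: complex. L * Re z = (cmod z)\<^sup>2 \<longrightarrow> (let w = \<Sum>i\<le>n. of_real (c i) * z ^ i; y = (cmod z)\<^sup>2 in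
       (cmod w)\<^sup>2 = poly r y \<and> Re w = poly a y \<and> Im z * Im w = poly b y))"
proof (induction n arbitrary: c)
  case 0
  show ?case
    by (intro exI[of _ "[:(c 0)\<^sup>2:]"] exI[of _ "[:c 0:]"] exI[of _ 0]) (simp add: Let_def norm_of_real)
next
  case (Suc n)
  obtain r a b :: "real poly" where deg: "degree r \<le> n" "degree a \<le> n" "degree b \<le> Suc n"
    and eq: "\<And>z. L * Re z = (cmod z)\<^sup>2 \<Longrightarrow> (let w = \<Sum>i\<le>n. of_real (c (Suc i)) * z ^ i; y = (cmod z)\<^sup>2 in
       (cmod w)\<^sup>2 = poly r y \<and> Re w = poly a y \<and> Im z * Im w = poly b y)"
    using Suc.IH[of "\<lambda>i. c (Suc i)"] by blast
  \<comment> \<open>\<open>x\<close>, \<open>s\<close> and \<open>h\<close> represent \<open>Re z\<close>, \<open>(Im z)\<^sup>2\<close> and \<open>Re (z v)\<close> as polynomials in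
    \<open>|z|\<^sup>2\<close>, where \<open>w = c\<^sub>0 + z v\<close>.\<close>
  define x :: "real poly" where "x = [:0, 1 / L:]"
  define s :: "real poly" where "s = [:0, 1, - 1 / L\<^sup>2:]"
  define h where "h = x * a - b"
  define r' where "r' = [:(c 0)\<^sup>2:] + smult (2 * c 0) h + pCons 0 r"
  have "degree (x * a) \<le> Suc n" "degree (x * b) \<le> Suc (Suc n)" "degree (s * a) \<le> Suc (Suc n)"
    using degree_mult_le[of x a] degree_mult_le[of x b] degree_mult_le[of s a] deg
    by (auto simp: x_def s_def split: if_splits)
  hence "degree h \<le> Suc n" "degree (s * a + x * b) \<le> Suc (Suc n)"
    unfolding h_def using deg by (auto intro: degree_diff_le degree_add_le)
  hence "degree ([:c 0:] + h) \<le> Suc n" "degree r' \<le> Suc n"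
    unfolding r'_def using deg
    by (auto intro!: degree_add_le order.trans[OF degree_smult_le])
  moreover have "let w = \<Sum>i\<le>Suc n. of_real (c i) * z ^ i; y = (cmod z)\<^sup>2 in
       (cmod w)\<^sup>2 = poly r' y \<and> Re w = poly ([:c 0:] + h) y \<and> Im z * Im w = poly (s * a + x * b) y"
    if z: "L * Re z = (cmod z)\<^sup>2" for z
  proof -
    define v where "v = (\<Sum>i\<le>n. of_real (c (Suc i)) * z ^ i)"
    define y where "y = (cmod z)\<^sup>2"
    have w: "(\<Sum>i\<le>Suc n. of_real (c i) * z ^ i) = of_real (c 0) + z * v"
      by (simp add: sum.atMost_Suc_shift v_def sum_distrib_left mult_ac del: sum.atMost_Suc)
    have v: "(cmod v)\<^sup>2 = poly r y" "Re v = poly a y" "Im z * Im v = poly b y"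
      using eq[OF z] by (auto simp: Let_def v_def y_def)
    have Re_z: "Re z = y / L" using z assms by (simp add: y_def field_simps)
    have Im_z: "(Im z)\<^sup>2 = y - y\<^sup>2 / L\<^sup>2"
      using cmod_power2[of z] unfolding y_def[symmetric] Re_z power_divide by simp
    have "Re (z * v) = poly h y"
      using v Re_z by (simp add: h_def x_def)
    moreover have "Im z * Im (z * v) = (Im z)\<^sup>2 * Re v + Re z * (Im z * Im v)"
      by (simp add: algebra_simps power2_eq_square)
    hence "Im z * Im (z * v) = poly (s * a + x * b) y"
      unfolding Im_z Re_z v by (simp add: s_def x_def power2_eq_square algebra_simps)
    moreover have "(cmod (of_real (c 0) + z * v))\<^sup>2 = (c 0)\<^sup>2 + 2 * c 0 * Re (z * v) + (cmod (z * v))\<^sup>2"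
      by (simp only: cmod_power2) (simp add: power2_sum)
    hence "(cmod (of_real (c 0) + z * v))\<^sup>2 = (c 0)\<^sup>2 + 2 * c 0 * Re (z * v) + (cmod z)\<^sup>2 * (cmod v)\<^sup>2"
      by (simp only: norm_mult power_mult_distrib)
    ultimately show ?thesis
      unfolding w Let_def y_def[symmetric] using v by (simp add: r'_def)
  qed
  moreover note \<open>degree (s * a + x * b) \<le> _\<close>
  ultimately show ?case by blast
qed



text \<open>The substitution \<open>|z|\<^sup>2 = L\<^sup>2 y\<close> turns \<open>(|z| |P(z)|\<^sup>K)\<^sup>2\<close> into \<open>L\<^sup>2 y s(y)\<^sup>K\<close> with a real
  polynomial \<open>s\<close> on the unit interval.\<close>
lemma exists_extremal_circle_point:
  fixes c :: "nat \<Rightarrow> real" and L :: real and p :: nat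
  defines "P \<equiv> \<lambda>z :: complex. \<Sum>i\<le>p. of_real (c i) * z ^ i"
  assumes "0 < L" "1 \<le> p" "1 \<le> K" "c 0 = 1"
    and bounded: "\<And>z. z \<noteq> 0 \<Longrightarrow> L * Re z = (cmod z)\<^sup>2 \<Longrightarrow> cmod (P z) \<le> 1"
  shows "\<exists>z. z \<noteq> 0 \<and> L * Re z = (cmod z)\<^sup>2 \<and> L / (4 * real p * sqrt (real K)) \<le> cmod z * cmod (P z) ^ K"
proof -
  obtain r :: "real poly" where r: "degree r \<le> p"
    "\<And>z. L * Re z = (cmod z)\<^sup>2 \<Longrightarrow> (cmod (P z))\<^sup>2 = poly r ((cmod z)\<^sup>2)"
    using circle_norm_squared_eq_poly[of L p c] assms(2) unfolding P_def Let_def by auto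
  define s where "s = pcompose r [:0, L\<^sup>2:]"
  have s: "poly s y = poly r (L\<^sup>2 * y)" for y
    by (simp add: s_def poly_pcompose mult.commute)
  have "degree s \<le> p"
    using r(1) by (simp add: s_def degree_pcompose)
  have on_circle: "\<exists>z. z \<noteq> 0 \<and> L * Re z = (cmod z)\<^sup>2 \<and> (cmod z)\<^sup>2 = L\<^sup>2 * y" if "0 < y" "y \<le> 1" for y
  proof -
    have "y\<^sup>2 \<le> y" using that by (simp add: power2_eq_square mult_left_le)
    hence "(cmod (Complex (L * y) (L * sqrt (y - y\<^sup>2))))\<^sup>2 = L\<^sup>2 * y"
      unfolding cmod_power2 by (simp add: power_mult_distrib right_diff_distrib)
    moreover have "L * Re (Complex (L * y) (L * sqrt (y - y\<^sup>2))) = L\<^sup>2 * y"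
      by (simp add: power2_eq_square)
    moreover have "Complex (L * y) (L * sqrt (y - y\<^sup>2)) \<noteq> 0"
      using that assms(2) by (simp add: complex_eq_iff)
    ultimately show ?thesis by metis
  qed
  have "P 0 = (\<Sum>i\<le>p. if i = 0 then 1 else 0)"
    unfolding P_def using assms(5) by (intro sum.cong) auto
  hence "cmod (P 0) = 1"
    by simp
  hence s_0: "poly s 0 = 1"
    using r(2)[of 0] by (simp add: s)
  have s_bounds: "0 \<le> poly s y \<and> poly s y \<le> 1" if y01: "0 < y" "y \<le> 1" for y
  proof -
    obtain z where z: "z \<noteq> 0" "L * Re z = (cmod z)\<^sup>2" "(cmod z)\<^sup>2 = L\<^sup>2 * y"
      using on_circle[OF y01] by blast
    hence "poly s y = (cmod (P z))\<^sup>2"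
      using r(2)[of z] by (simp add: s)
    thus ?thesis using bounded[of z] z by (simp add: abs_square_le_1)
  qed
  obtain y where y: "0 < y" "y \<le> 1" "1 / (16 * real K * (real p)\<^sup>2) \<le> y * poly s y ^ K"
    using exists_large_damped_value[OF \<open>degree s \<le> p\<close> assms(3,4) s_0 s_bounds] by blast
  obtain z where z: "z \<noteq> 0" "L * Re z = (cmod z)\<^sup>2" "(cmod z)\<^sup>2 = L\<^sup>2 * y"
    using on_circle[OF y(1,2)] by blast
  have "(L / (4 * real p * sqrt (real K)))\<^sup>2 = L\<^sup>2 * (1 / (16 * real K * (real p)\<^sup>2))"
    by (simp add: power_divide power_mult_distrib)
  also have "\<dots> \<le> L\<^sup>2 * (y * poly s y ^ K)"
    using y(3) by (intro mult_left_mono) auto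
  also have "\<dots> = (cmod z * cmod (P z) ^ K)\<^sup>2"
  proof -
    have "(cmod z * cmod (P z) ^ K)\<^sup>2 = (cmod z)\<^sup>2 * ((cmod (P z))\<^sup>2) ^ K"
      unfolding power_mult_distrib power_mult[symmetric] mult.commute[of K 2] ..
    thus ?thesis using r(2)[OF z(2)] z(3) by (simp add: s)
  qed
  finally have "L / (4 * real p * sqrt (real K)) \<le> cmod z * cmod (P z) ^ K"
    by (rule power2_le_imp_le) simp
  thus ?thesis using z by blast
qed

section \<open>Matrices acting as complex numbers\<close>

lemma exists_fixpoint_free_involution:
  assumes "finite S" and "even (card S)"
  shows "\<exists>\<sigma> T. T \<subseteq> S \<and> (\<forall>i\<in>S. \<sigma> i \<in> S \<and> \<sigma> (\<sigma> i) = i \<and> (\<sigma> i \<in> T \<longleftrightarrow> i \<notin> T))"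
proof -
  obtain m where m: "card S = 2 * m"
    using assms(2) by blast
  obtain T where T: "T \<subseteq> S" "card T = m" "finite T"
    by (rule obtain_subset_with_card_n[of m S]) (simp_all add: m)
  have "card (S - T) = card T"
    by (simp add: card_Diff_subset T m)
  then obtain f where f: "bij_betw f T (S - T)"
    using finite_same_card_bij[of T "S - T"] T(3) assms(1) by fastforce
  define g where "g = inv_into T f"
  define \<sigma> where "\<sigma> i = (if i \<in> T then f i else g i)" for i
  have "\<sigma> i \<in> S \<and> \<sigma> (\<sigma> i) = i \<and> (\<sigma> i \<in> T \<longleftrightarrow> i \<notin> T)" if "i \<in> S" for i
  proof (cases "i \<in> T")
    case True
    have "f i \<in> S - T" "g (f i) = i"
      unfolding g_def using bij_betwE[OF f] bij_betw_inv_into_left[OF f] True by blast+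
    thus ?thesis using True by (simp add: \<sigma>_def)
  next
    case False
    hence "i \<in> S - T" using that by blast
    hence "g i \<in> T" "f (g i) = i"
      unfolding g_def using bij_betwE[OF bij_betw_inv_into[OF f]] bij_betw_inv_into_right[OF f] by blast+
    thus ?thesis using False T(1) by (auto simp: \<sigma>_def)
  qed
  thus ?thesis using T(1) by blast
qed

text \<open>An orthogonal complex structure on the Euclidean space: a skew isometry that squares to
  \<open>-1\<close>.\<close>
definition complex_structure :: "real^'n^'n \<Rightarrow> bool" where
  "complex_structure J \<longleftrightarrow> (\<forall>v. J *v (J *v v) = - v) \<and>
     (\<forall>v. inner (J *v v) v = 0) \<and> (\<forall>v. norm (J *v v) = norm v)"

text \<open>Pairing the coordinates by a fixed-point-free involution \<open>\<sigma>\<close>, the matrix \<open>J\<close> swaps each pair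
  and changes one sign, like the rotation by a right angle in each coordinate plane.\<close>
lemma exists_complex_structure:
  assumes "even (CARD('n::finite))"
  shows "\<exists>J :: real^'n^'n. complex_structure J"
proof -
  obtain \<sigma> :: "'n \<Rightarrow> 'n" and T where \<sigma>: "\<And>i. \<sigma> (\<sigma> i) = i" "\<And>i. \<sigma> i \<in> T \<longleftrightarrow> i \<notin> T"
    using exists_fixpoint_free_involution[of "UNIV :: 'n set"] assms by auto
  define s :: "'n \<Rightarrow> real" where "s i = (if i \<in> T then 1 else - 1)" for i
  have s: "s (\<sigma> i) = - s i" "s i * s i = 1" for i using \<sigma>(2) by (auto simp: s_def)
  define J :: "real^'n^'n" where "J = (\<chi> i j. if j = \<sigma> i then s i else 0)"
  have J: "(J *v v) $ i = s i * v $ \<sigma> i" for v i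
    by (simp add: J_def matrix_vector_mult_def if_distrib[of "\<lambda>x. x * _"] cong: if_cong)
  have bij: "bij \<sigma>" using \<sigma>(1) by (metis bijI')
  have swap: "(\<Sum>i\<in>UNIV. f (\<sigma> i)) = (\<Sum>i\<in>UNIV. f i)" for f :: "'n \<Rightarrow> real"
    using bij by (rule sum.reindex_bij_betw)
  have "J *v (J *v v) = - v" for v
    by (simp add: vec_eq_iff J \<sigma>(1) s mult.assoc[symmetric])
  moreover have "inner (J *v v) v = 0" for v
  proof -
    have "inner (J *v v) v = (\<Sum>i\<in>UNIV. s (\<sigma> i) * v $ \<sigma> (\<sigma> i) * v $ \<sigma> i)"
      by (subst swap) (simp add: inner_vec_def J)
    also have "\<dots> = - inner (J *v v) v"
      by (simp add: inner_vec_def J s \<sigma>(1) sum_negf mult_ac)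
    finally show ?thesis by simp
  qed
  moreover have "norm (J *v v) = norm v" for v
  proof -
    have "inner (J *v v) (J *v v) = (\<Sum>i\<in>UNIV. (s i * s i) * (v $ \<sigma> i * v $ \<sigma> i))"
      by (simp add: inner_vec_def J mult_ac)
    also have "\<dots> = inner v v"
      using swap[of "\<lambda>i. v $ i * v $ i"] by (simp add: inner_vec_def s)
    finally show ?thesis by (simp add: norm_eq_sqrt_inner)
  qed
  ultimately show ?thesis unfolding complex_structure_def by blast
qed

text \<open>For a complex structure \<open>J\<close>, this is multiplication by \<open>z\<close> with \<open>J\<close> in the role of the
  imaginary unit.\<close>
definition cmatrix :: "real^'n^'n \<Rightarrow> complex \<Rightarrow> real^'n^'n" where
  "cmatrix J z = Re z *\<^sub>R mat 1 + Im z *\<^sub>R J"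

lemma cmatrix_vector: "cmatrix J z *v v = Re z *\<^sub>R v + Im z *\<^sub>R (J *v v)"
  by (simp add: cmatrix_def matrix_vector_mult_add_rdistrib scaleR_matrix_vector_assoc[symmetric])

lemma cmatrix_0 [simp]: "cmatrix J 0 = 0" and cmatrix_1 [simp]: "cmatrix J 1 = mat 1"
  by (simp_all add: cmatrix_def)

lemma cmatrix_add: "cmatrix J (z + w) = cmatrix J z + cmatrix J w"
  by (simp add: cmatrix_def algebra_simps)

lemma cmatrix_of_real_mult: "cmatrix J (of_real c * z) = c *\<^sub>R cmatrix J z"
  by (simp add: cmatrix_def algebra_simps)

lemma cmatrix_sum: "cmatrix J (sum f S) = (\<Sum>i\<in>S. cmatrix J (f i))"
  by (induction S rule: infinite_finite_induct) (simp_all add: cmatrix_add)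

context
  fixes J :: "real^'n::finite^'n"
  assumes J: "complex_structure J"
begin

lemma cmatrix_mult: "cmatrix J z ** cmatrix J w = cmatrix J (z * w)"
proof -
  have "J *v (J *v v) = - v" for v
    using J by (simp add: complex_structure_def)
  hence "cmatrix J z *v (cmatrix J w *v v)
      = Re w *\<^sub>R (Re z *\<^sub>R v + Im z *\<^sub>R (J *v v)) + Im w *\<^sub>R (Re z *\<^sub>R (J *v v) - Im z *\<^sub>R v)" for v
    by (simp add: cmatrix_vector matrix_vector_right_distrib matrix_vector_mult_scaleR)
  hence "(cmatrix J z ** cmatrix J w) *v v = cmatrix J (z * w) *v v" for v
    unfolding matrix_vector_mul_assoc[symmetric]
    by (simp add: cmatrix_vector[of J "w * z"] scaleR_add_right scaleR_diff_right scaleR_add_left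
        scaleR_diff_left mult.commute)
  thus ?thesis by (simp add: matrix_eq)
qed

lemma cmatrix_mult_vector: "cmatrix J z *v (cmatrix J w *v v) = cmatrix J (z * w) *v v"
  by (simp add: matrix_vector_mul_assoc cmatrix_mult)

lemma inner_cmatrix: "inner (cmatrix J z *v v) v = Re z * (norm v)\<^sup>2"
  using J by (simp add: cmatrix_vector complex_structure_def inner_add_left power2_norm_eq_inner)

lemma norm_cmatrix: "norm (cmatrix J z *v v) = cmod z * norm v"
proof -
  have "inner (J *v v) v = 0" "inner v (J *v v) = 0" "inner (J *v v) (J *v v) = inner v v"
    using J by (simp_all add: complex_structure_def norm_eq inner_commute)
  hence "(norm (cmatrix J z *v v))\<^sup>2 = ((Re z)\<^sup>2 + (Im z)\<^sup>2) * inner v v"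
    unfolding power2_norm_eq_inner cmatrix_vector
    by (simp add: inner_add_left inner_add_right algebra_simps power2_eq_square)
  hence "(norm (cmatrix J z *v v))\<^sup>2 = (cmod z)\<^sup>2 * (norm v)\<^sup>2"
    by (simp add: cmod_power2 power2_norm_eq_inner[of v])
  thus ?thesis by (metis mult_nonneg_nonneg norm_ge_zero power2_eq_imp_eq power_mult_distrib)
qed

lemma cmatrix_power: "((**) (cmatrix J z) ^^ i) (mat 1) = cmatrix J (z ^ i)"
  by (induction i) (simp_all add: cmatrix_mult)

lemma matrix_poly_cmatrix:
  "matrix_poly q (cmatrix J z) = cmatrix J (\<Sum>i\<le>degree q. of_real (coeff q i) * z ^ i)"
  by (simp add: matrix_poly_def cmatrix_power cmatrix_sum cmatrix_of_real_mult)

lemma cmatrix_inverse: "z \<noteq> 0 \<Longrightarrow> cmatrix J (inverse z) ** cmatrix J z = mat 1"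
  by (simp add: cmatrix_mult)

lemma cmatrix_nonsingular:
  assumes "z \<noteq> 0"
  shows "rank (cmatrix J z) = CARD('n)" and "matrix_inv (cmatrix J z) *v (cmatrix J z *v v) = v"
proof -
  have "inj ((*v) (cmatrix J z))"
    using cmatrix_inverse[OF assms] by (auto intro: inj_on_inverseI[of _ "(*v) (cmatrix J (inverse z))"] simp: matrix_vector_mul_assoc)
  thus "rank (cmatrix J z) = CARD('n)" by (simp add: full_rank_injective[symmetric])
  have "\<exists>A'. cmatrix J z ** A' = mat 1 \<and> A' ** cmatrix J z = mat 1"
    using assms by (intro exI[of _ "cmatrix J (inverse z)"]) (simp add: cmatrix_mult)
  hence "matrix_inv (cmatrix J z) ** cmatrix J z = mat 1"
    unfolding matrix_inv_def by (rule someI2_ex) blast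
  thus "matrix_inv (cmatrix J z) *v (cmatrix J z *v v) = v"
    by (simp add: matrix_vector_mul_assoc)
qed

text \<open>Since \<open>z\<close> contributes \<open>Re z |v|\<^sup>2\<close> to the inner product and \<open>|z|\<^sup>2 |v|\<^sup>2\<close> to the squared
  norm, cocoercivity reduces to a condition on \<open>z\<close> alone. The vector \<open>u\<close> is the prescribed
  solution.\<close>
lemma cmatrix_mem_problem_class:
  assumes "0 < L" "(cmod z)\<^sup>2 \<le> L * Re z" "norm u \<le> D"
  shows "(cmatrix J z, - (cmatrix J z *v u)) \<in> problem_class L D 0"
proof -
  have "1 / L * (norm (cmatrix J z *v v))\<^sup>2 \<le> inner (cmatrix J z *v v) v" for v
  proof -
    have "1 / L * ((cmod z)\<^sup>2 * (norm v)\<^sup>2) \<le> 1 / L * (L * Re z * (norm v)\<^sup>2)"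
      using assms by (intro mult_left_mono mult_right_mono) auto
    thus ?thesis using assms(1) by (simp add: norm_cmatrix inner_cmatrix power_mult_distrib)
  qed
  moreover have "affine_op (cmatrix J z) b v - affine_op (cmatrix J z) b w = cmatrix J z *v (v - w)" for b v w
    by (simp add: affine_op_def matrix_vector_mult_diff_distrib)
  ultimately have "cocoercive (1 / L) (affine_op (cmatrix J z) b)" for b
    by (simp add: cocoercive_def)
  moreover have "affine_op (cmatrix J z) (- (cmatrix J z *v u)) u = 0"
    by (simp add: affine_op_def)
  ultimately show ?thesis using assms(3) by (auto simp: problem_class_def intro!: exI[of _ u])
qed

end

section \<open>Consistent algorithms\<close>

text \<open>The limit of the iterates inherits the recursion, since one step is continuous.\<close>
lemma consistent_SCLI_fixed_point:
  assumes "is_1_SCLI u\<^sub>0 C N U" and "U A b \<longlonglongrightarrow> u"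
  shows "C A *v u + N A *v b = u"
proof (rule LIMSEQ_unique)
  show "(\<lambda>k. U A b (Suc k)) \<longlonglongrightarrow> u"
    using assms(2) by (rule LIMSEQ_Suc)
  have "isCont (\<lambda>v. C A *v v + N A *v b) u"
    by (intro continuous_intros linear_continuous_at matrix_vector_mul_bounded_linear)
  hence "(\<lambda>k. C A *v U A b k + N A *v b) \<longlonglongrightarrow> C A *v u + N A *v b"
    using assms(2) by (rule isCont_tendsto_compose)
  thus "(\<lambda>k. U A b (Suc k)) \<longlonglongrightarrow> C A *v u + N A *v b"
    using assms(1) by (simp add: is_1_SCLI_def)
qed


text \<open>Every vector \<open>v\<close> is the solution for \<open>b = -A v\<close>, so the fixed-point equation holds for all
  \<open>v\<close> and determines \<open>C\<close> on this \<open>A\<close>: it multiplies by \<open>P q z\<close>. Hence each step multiplies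
  the error by \<open>P q z\<close>, starting from the error \<open>u\<close> at the initial point 0.\<close>
lemma SCLI_residual_cmatrix:
  fixes J :: "real^'n::finite^'n"
  defines "P \<equiv> \<lambda>q z :: complex. 1 + z * (\<Sum>i\<le>degree q. of_real (coeff q i) * z ^ i)"
  assumes J: "complex_structure J" and "z \<noteq> 0"
    and SCLI: "is_1_SCLI 0 C N U" and cons: "consistent_wrt U (cmatrix J z)"
    and N: "N (cmatrix J z) = matrix_poly q (cmatrix J z)"
  shows "norm (affine_op (cmatrix J z) (- (cmatrix J z *v u)) (U (cmatrix J z) (- (cmatrix J z *v u)) k))
     = cmod z * cmod (P q z) ^ k * norm u" (is "?residual")
    and "u \<noteq> 0 \<Longrightarrow> (\<lambda>k. cmod (P q z) ^ k) \<longlonglongrightarrow> 0"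
proof -
  note mult = cmatrix_mult_vector[OF J]
  have neg: "M *v (- v) = - (M *v v)" for M :: "real^'n^'n" and v
    by (rule linear_neg[OF matrix_vector_mul_linear])
  define A where "A = cmatrix J z"
  define b where "b = - (A *v u)"
  have lim: "U A (- (A *v v)) \<longlonglongrightarrow> v" for v
  proof -
    have "- (matrix_inv A *v (- (A *v v))) = v"
      using cmatrix_nonsingular(2)[OF J \<open>z \<noteq> 0\<close>, of v] by (simp add: A_def neg)
    thus ?thesis using cons unfolding consistent_wrt_def A_def by metis
  qed
  \<comment> \<open>The fixed-point equation for the instance with solution \<open>v\<close>, solved for \<open>C A v\<close>.\<close>
  have C: "C A *v v = cmatrix J (P q z) *v v" for v
  proof -
    have "C A *v v = v - N A *v (- (A *v v))"
      using consistent_SCLI_fixed_point[OF SCLI lim, of v] by (metis add_diff_cancel_right')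
    also have "\<dots> = cmatrix J (P q z) *v v"
      by (simp add: A_def N neg matrix_poly_cmatrix[OF J] mult P_def cmatrix_add matrix_vector_mult_add_rdistrib mult.commute)
    finally show ?thesis .
  qed
  have error: "U A b k = u - cmatrix J (P q z ^ k) *v u" for k
  proof (induction k)
    case 0
    show ?case using SCLI by (simp add: is_1_SCLI_def)
  next
    case (Suc k)
    have "U A b (Suc k) = C A *v U A b k + N A *v b"
      using SCLI by (simp add: is_1_SCLI_def)
    also have "\<dots> = (C A *v u + N A *v b) - C A *v (cmatrix J (P q z ^ k) *v u)"
      by (simp add: Suc matrix_vector_mult_diff_distrib)
    also have "C A *v u + N A *v b = u"
      using consistent_SCLI_fixed_point[OF SCLI lim] by (simp add: b_def)
    finally show ?case by (simp add: C mult)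
  qed
  have "affine_op A b (U A b k) = - (cmatrix J (z * P q z ^ k) *v u)"
    unfolding error by (simp add: affine_op_def b_def matrix_vector_mult_diff_distrib A_def mult)
  thus ?residual
    unfolding A_def[symmetric] b_def[symmetric] by (simp add: norm_cmatrix[OF J] norm_mult norm_power)
  assume "u \<noteq> 0"
  have "(\<lambda>k. norm (u - U A b k) / norm u) \<longlonglongrightarrow> norm (u - u) / norm u"
    using lim[of u] \<open>u \<noteq> 0\<close> unfolding b_def[symmetric] by (intro tendsto_intros) auto
  thus "(\<lambda>k. cmod (P q z) ^ k) \<longlonglongrightarrow> 0"
    using \<open>u \<noteq> 0\<close> by (simp add: error norm_cmatrix[OF J] norm_power)
qed

section \<open>The lower bound\<close>

theorem theorem3p7:
  fixes C\<^sub>0 N :: "real^'n^'n \<Rightarrow> real^'n^'n"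
    and U :: "'n::finite algorithm"
    and L D :: real and p K :: nat
  assumes "CARD('n) \<ge> 2" and "even (CARD('n))"
    and "p \<ge> 1" and "K \<ge> 1" and "L > 0" and "D > 0"
    and "is_1_SCLI 0 C\<^sub>0 N U"
    and "consistent_on (fst ` problem_class L D 0) U"
    and "\<exists>q. degree q \<le> p - 1 \<and> (\<forall>A. N A = matrix_poly q A)"
  shows "(SUP (A, b) \<in> problem_class L D 0. ereal (norm (affine_op A b (U A b K))))
           \<ge> ereal (L * D / (4 * real p * sqrt (5 * real K)))"
proof -
  obtain J :: "real^'n^'n" where J: "complex_structure J"
    using exists_complex_structure assms(2) by blast
  obtain q where q: "degree q \<le> p - 1" "\<And>A. N A = matrix_poly q A"
    using assms(9) by blast
  obtain u :: "real^'n" where u: "norm u = D"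
    using vector_choose_size[of D] assms(6) by auto
  define c where "c i = coeff (pCons 1 q) i" for i
  define P where "P z = 1 + z * (\<Sum>i\<le>degree q. of_real (coeff q i) * z ^ i)" for z :: complex
  have P: "P z = (\<Sum>i\<le>p. of_real (c i) * z ^ i)" for z
  proof -
    have "(\<Sum>i\<le>degree q. of_real (coeff q i) * z ^ i) = (\<Sum>i\<le>p - 1. of_real (coeff q i) * z ^ i)"
      using q(1) by (intro sum.mono_neutral_left) (auto simp: coeff_eq_0)
    moreover obtain m where "p = Suc m" using assms(3) by (cases p) auto
    ultimately show ?thesis
      by (simp add: P_def c_def sum.atMost_Suc_shift sum_distrib_left mult_ac del: sum.atMost_Suc)
  qed
  define A where "A z = cmatrix J z" for z
  define b where "b z = - (A z *v u)" for z
  have mem: "(A z, b z) \<in> problem_class L D 0" if "L * Re z = (cmod z)\<^sup>2" for z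
    unfolding A_def b_def using J assms(5) that u by (intro cmatrix_mem_problem_class) auto
  have cons: "consistent_wrt U (A z)" if "z \<noteq> 0" "L * Re z = (cmod z)\<^sup>2" for z
    using assms(8) mem[OF that(2)] cmatrix_nonsingular(1)[OF J that(1)]
    unfolding consistent_on_def A_def by force
  note residual = SCLI_residual_cmatrix[OF J _ assms(7) cons[unfolded A_def] q(2), folded P_def A_def]
  have "cmod (P z) \<le> 1" if "z \<noteq> 0" "L * Re z = (cmod z)\<^sup>2" for z
  proof -
    have "(\<lambda>k. cmod (P z) ^ k) \<longlonglongrightarrow> 0"
      using residual(2)[of z u] that u assms(6) by auto
    thus ?thesis
      using LIMSEQ_le_const[of "\<lambda>k. cmod (P z) ^ k" 0 1] one_le_power[of "cmod (P z)"] by fastforce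
  qed
  then obtain z where z: "z \<noteq> 0" "L * Re z = (cmod z)\<^sup>2"
    "L / (4 * real p * sqrt (real K)) \<le> cmod z * cmod (P z) ^ K"
    using exists_extremal_circle_point[OF assms(5,3,4), of c] unfolding P by (auto simp: c_def)
  have "L * D / (4 * real p * sqrt (5 * real K)) \<le> L * D / (4 * real p * sqrt (real K))"
    using assms(3-6) by (intro divide_left_mono mult_left_mono real_sqrt_le_mono) auto
  also have "\<dots> = L / (4 * real p * sqrt (real K)) * D" by simp
  also have "\<dots> \<le> cmod z * cmod (P z) ^ K * D"
    using z(3) assms(6) by (intro mult_right_mono) auto
  also have "\<dots> = norm (affine_op (A z) (b z) (U (A z) (b z) K))"
    using residual(1)[of z u K] z u by (simp add: b_def)
  finally show ?thesis
    using mem[OF z(2)] by (intro SUP_upper2[of "(A z, b z)"]) auto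
qed

end
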